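(* Let $X$ be a topological space. Let $f, p : X \to \Omega(X)$ be the maps defined, for each $x \in X$, by $$f(x) = \bigcup\{U \in \Omega(X) \mid \exists V \in \mathcal{N}_x,\ U \cap V = \emptyset\}, \qquad p(x) = X \setminus \overline{\{x\}}.$$ Then $X$ is preregular if and only if $f = p$.
   Context: For a topological space $X$, $\Omega(X)$ denotes its locale (frame) of open sets, ordered by inclusion. For $x \in X$, $\mathcal{N}_x \subseteq \Omega(X)$ denotes the set of all open neighborhoods of $x$, and $\overline{\{x\}}$ is the closure of $\{x\}$. Thus $f(x)=\phi(\mathcal{N}_x)$, where for $\mathcal{U}\subseteq \Omega(X)$ open in the Scott topology of $\Omega(X)$ one puts $\phi(\mathcal{U}) = \bigcup\{U \in \Omega(X) \mid \exists V \in \mathcal{U},\ U \cap V = \emptyset\}$ (the set $\mathcal{N}_x$ is Scott open). Two points $x,y \in X$ are topologically indistinguishable if $\mathcal{N}_x = \mathcal{N}_y$, and topologically distinguishable otherwise. The space $X$ is preregular (or $R_1$) if any two topologically distinguishable points $x,y$ can be separated by disjoint neighborhoods, i.e. there are $U \in \mathcal{N}_x$ and $V \in \mathcal{N}_y$ with $U \cap V = \emptyset$. *)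

theory Defs
  imports "HOL-Analysis.Analysis"
begin

definition opens_of :: "'a topology \<Rightarrow> 'a set set" where
  "opens_of X = {U. openin X U}"

definition open_nbhds :: "'a topology \<Rightarrow> 'a \<Rightarrow> 'a set set" where
  "open_nbhds X x = {U \<in> opens_of X. x \<in> U}"

definition top_indistinguishable :: "'a topology \<Rightarrow> 'a \<Rightarrow> 'a \<Rightarrow> bool" where
  "top_indistinguishable X x y \<longleftrightarrow> open_nbhds X x = open_nbhds X y"

definition preregular_space :: "'a topology \<Rightarrow> bool" where
  "preregular_space X \<longleftrightarrow>
     (\<forall>x\<in>topspace X. \<forall>y\<in>topspace X. \<not> top_indistinguishable X x y \<longrightarrow>
        (\<exists>U\<in>open_nbhds X x. \<exists>V\<in>open_nbhds X y. U \<inter> V = {}))"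

(* The maps f and p have domain topspace X, so they are extensional functions
   (undefined outside topspace X); HOL equality of them is then exactly
   equality as maps topspace X -> opens_of X. *)

definition sep_map :: "'a topology \<Rightarrow> 'a \<Rightarrow> 'a set" where
  "sep_map X = (\<lambda>x\<in>topspace X. \<Union>{U \<in> opens_of X. \<exists>V\<in>open_nbhds X x. U \<inter> V = {}})"

definition point_map :: "'a topology \<Rightarrow> 'a \<Rightarrow> 'a set" where
  "point_map X = (\<lambda>x\<in>topspace X. topspace X - X closure_of {x})"

lemma sep_map_in_opens: "sep_map X \<in> topspace X \<rightarrow>\<^sub>E opens_of X"
  by (auto simp: sep_map_def opens_of_def intro!: openin_Union)

lemma point_map_in_opens: "point_map X \<in> topspace X \<rightarrow>\<^sub>E opens_of X"
  by (auto simp: point_map_def opens_of_def)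

end

theory Submission
  imports Defs
begin

text \<open>Read both maps as relations: \<open>y \<in> sep_map X x\<close> says that
  \<open>x\<close> and \<open>y\<close> have disjoint open neighborhoods,
  \<open>y \<in> point_map X x\<close> that some open neighborhood of \<open>y\<close> misses
  \<open>x\<close>. The first always implies the second (\<open>sep_map_subset_point_map\<close>),
  and distinguishability is the symmetrization of the second
  (\<open>not_top_indistinguishable_iff\<close>). As separation is symmetric, preregularity amounts
  to the converse implication, hence to equality of the maps.\<close>

lemma mem_sep_map_iff:
  assumes "x \<in> topspace X"
  shows "y \<in> sep_map X x \<longleftrightarrow> (\<exists>U\<in>open_nbhds X x. \<exists>V\<in>open_nbhds X y. U \<inter> V = {})"
  using assms by (auto simp: sep_map_def open_nbhds_def Int_commute)

lemma mem_point_map_iff: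
  assumes "x \<in> topspace X"
  shows "y \<in> point_map X x \<longleftrightarrow> (\<exists>V\<in>open_nbhds X y. x \<notin> V)"
  using assms
  by (auto simp: point_map_def open_nbhds_def opens_of_def in_closure_of dest: openin_subset)

text \<open>A neighborhood of \<open>y\<close> disjoint from one of \<open>x\<close> cannot contain
  \<open>x\<close>.\<close>

lemma sep_map_subset_point_map:
  assumes "x \<in> topspace X"
  shows "sep_map X x \<subseteq> point_map X x"
proof
  fix y assume "y \<in> sep_map X x"
  with assms show "y \<in> point_map X x"
    unfolding mem_sep_map_iff[OF assms] mem_point_map_iff[OF assms]
    by (auto simp: open_nbhds_def)
qed

text \<open>The neighborhood systems differ exactly when some open set contains one point but not
  the other; the disjuncts record which one.\<close>

lemma not_top_indistinguishable_iff:
  assumes "x \<in> topspace X" "y \<in> topspace X"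
  shows "\<not> top_indistinguishable X x y \<longleftrightarrow> y \<in> point_map X x \<or> x \<in> point_map X y"
  unfolding mem_point_map_iff[OF assms(1)] mem_point_map_iff[OF assms(2)]
  by (auto simp: top_indistinguishable_def open_nbhds_def)

theorem theorem3p3:
  fixes X :: "'a topology"
  shows "preregular_space X \<longleftrightarrow> sep_map X = point_map X"
proof
  assume pre: "preregular_space X"
  show "sep_map X = point_map X"
  proof (rule extensionalityI[of _ "topspace X"])
    show "sep_map X \<in> extensional (topspace X)" "point_map X \<in> extensional (topspace X)"
      by (simp_all add: sep_map_def point_map_def)
  next
    fix x assume x: "x \<in> topspace X"
    have "point_map X x \<subseteq> sep_map X x"
    proof
      fix y assume y: "y \<in> point_map X x"
      with x have "y \<in> topspace X"
        by (simp add: point_map_def)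
      with x y pre show "y \<in> sep_map X x"
        by (simp add: preregular_space_def not_top_indistinguishable_iff mem_sep_map_iff)
    qed
    with sep_map_subset_point_map[OF x] show "sep_map X x = point_map X x"
      by (rule equalityI)
  qed
next
  assume eq: "sep_map X = point_map X"
  show "preregular_space X"
    unfolding preregular_space_def
  proof (intro ballI impI)
    fix x y assume x: "x \<in> topspace X" and y: "y \<in> topspace X"
      and "\<not> top_indistinguishable X x y"
    then have "y \<in> sep_map X x \<or> x \<in> sep_map X y"
      by (simp add: eq not_top_indistinguishable_iff)
    \<comment> \<open>Whichever disjunct holds, swapping the two neighborhoods if necessary gives
      the required pair.\<close>
    then show "\<exists>U\<in>open_nbhds X x. \<exists>V\<in>open_nbhds X y. U \<inter> V = {}"
      unfolding mem_sep_map_iff[OF x] mem_sep_map_iff[OF y]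
      by (metis Int_commute)
  qed
qed

end
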